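(* For all $\beta_1,\beta_2>1$ with $\beta_1\neq\beta_2$, the set of uniqueness $\mathcal U_{\beta_1,\beta_2}\subset\mathbb R^2$ has positive Hausdorff dimension.
   Context: Write $p=+1$, $m=-1$. For $\beta_1,\beta_2>1$ define $\pi:\{p,m\}^{\mathbb N}\to\mathbb R^2$ by $\pi(w)=\left(\sum_{i\ge1}w_i\beta_1^{-i},\sum_{i\ge1}w_i\beta_2^{-i}\right)$. Let $U_{\beta_1,\beta_2}$ be the set of unique addresses, i.e. of $w\in\{p,m\}^{\mathbb N}$ such that $\pi(w')\ne\pi(w)$ for every $w'\in\{p,m\}^{\mathbb N}$ with $w'\neq w$. The set of uniqueness is $\mathcal U_{\beta_1,\beta_2}=\pi(U_{\beta_1,\beta_2})$. *)

theory Defs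
  imports "HOL-Analysis.Analysis"
begin

(* diam(A)^s with the conventions of Hausdorff measure: the empty set has weight 0 for
   every s, and a nonempty set has weight 1 for s = 0 (whereas 0 powr 0 = 0). *)
definition diam_weight :: "real \<Rightarrow> 'a::metric_space set \<Rightarrow> ennreal" where
  "diam_weight s A =
     (if A = {} then 0
      else if s = 0 then 1
      else ennreal (diameter A powr s))"

(* Finite covers are included, since members of the sequence may be empty. Boundedness is
   required because the library diameter of an unbounded set is unspecified. *)
definition hausdorff_premeasure :: "real \<Rightarrow> real \<Rightarrow> 'a::metric_space set \<Rightarrow> ennreal" where
  "hausdorff_premeasure s \<delta> A =
     (INF C \<in> {C :: nat \<Rightarrow> 'a set. A \<subseteq> (\<Union>n. C n) \<and> (\<forall>n. bounded (C n) \<and> diameter (C n) \<le> \<delta>)}.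
        \<Sum>n. diam_weight s (C n))"

definition hausdorff_outer_measure :: "real \<Rightarrow> 'a::metric_space set \<Rightarrow> ennreal" where
  "hausdorff_outer_measure s A = (SUP \<delta> \<in> {0<..}. hausdorff_premeasure s \<delta> A)"

definition hausdorff_dim :: "'a::metric_space set \<Rightarrow> ennreal" where
  "hausdorff_dim A = Inf {ennreal s | s. 0 \<le> s \<and> hausdorff_outer_measure s A = 0}"

(* The digits are p = 1 and m = -1. A sequence (w_i), i \<ge> 1, is stored as a function on nat
   with w_i at position i - 1. *)
definition pm_seqs :: "(nat \<Rightarrow> real) set" where
  "pm_seqs = {w. \<forall>n. w n \<in> {1, -1}}"

(* The plane carries the product metric of the library, which is the Euclidean one. *)
definition address_map :: "real \<Rightarrow> real \<Rightarrow> (nat \<Rightarrow> real) \<Rightarrow> real \<times> real" where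
  "address_map \<beta>1 \<beta>2 w = ((\<Sum>n. w n / \<beta>1 ^ Suc n), (\<Sum>n. w n / \<beta>2 ^ Suc n))"

definition unique_addresses :: "real \<Rightarrow> real \<Rightarrow> (nat \<Rightarrow> real) set" where
  "unique_addresses \<beta>1 \<beta>2 =
     {w \<in> pm_seqs. \<forall>w' \<in> pm_seqs. w' \<noteq> w \<longrightarrow> address_map \<beta>1 \<beta>2 w' \<noteq> address_map \<beta>1 \<beta>2 w}"

definition uniqueness_set :: "real \<Rightarrow> real \<Rightarrow> (real \<times> real) set" where
  "uniqueness_set \<beta>1 \<beta>2 = address_map \<beta>1 \<beta>2 ` unique_addresses \<beta>1 \<beta>2"

end

theory Submission
  imports Defs
begin

text \<open>
  The proof finds a Cantor set inside the set of uniqueness: for a large \<open>L\<close>, every address that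
  is constant on each block \<open>{L q..<L q + L}\<close> is unique, and these addresses are coded
  by arbitrary sequences of signs, one sign per block.

  Uniqueness (\<open>blocks_address_unique\<close>). Put \<open>x\<close> and \<open>y\<close> for the inverse bases, \<open>x < y\<close>. If \<open>w\<close> and
  \<open>w'\<close> have the same image, then every combination \<open>f n = x ^ n - c * y ^ n\<close> satisfies
  \<open>(\<Sum>n. (w n - w' n) * f n) = 0\<close>, and \<open>w n - w' n\<close> is either zero or has the sign of \<open>w n\<close>.
  Such an \<open>f\<close> changes its sign once, at a place that \<open>c\<close> controls. Let \<open>k\<close> be the first place where
  the addresses differ and let \<open>K > k\<close> be the next change of sign of \<open>w\<close> (if there is none,
  \<open>c = 0\<close> makes all terms have the sign of \<open>w k\<close>). With
  \<open>c = (x / y) ^ K\<close> the function \<open>f\<close> changes sign where \<open>w\<close> does, so all terms up to the end of the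
  run of \<open>w\<close> that begins at \<open>K\<close> have the sign of \<open>w k\<close>. This run has at least \<open>L\<close> digits, and hence
  what follows is smaller than the term at \<open>k\<close> by a factor of order \<open>y ^ L\<close>, uniformly in \<open>k\<close>
  and \<open>K\<close>. The sum cannot vanish. This is where two different bases are essential.

  Dimension. If two sequences of signs differ first in block \<open>q\<close>, already the first coordinates
  of the two points have distance at least \<open>z ^ (L * q + 1)\<close>, where \<open>z\<close> is the inverse of the
  first base (\<open>blocks_series_separated\<close>). Coding
  a number in \<open>[0,1)\<close> by its binary digits gives a map \<open>h\<close> from \<open>[0,1)\<close> into the set of
  uniqueness with \<open>\<bar>u - v\<bar> \<le> C * dist (h u) (h v) powr s\<close>, where \<open>(z ^ L) powr s = 1/2\<close>. Pulling a
  cover of the set of uniqueness back along \<open>h\<close> gives a cover of \<open>[0,1)\<close>, which has length one, so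
  the dimension is at least \<open>s\<close> (\<open>hausdorff_dim_ge_of_inverse_hoelder\<close>).
\<close>

section \<open>A lower bound for the Hausdorff dimension\<close>

text \<open>
  The inverse of \<open>h\<close> is Hoelder continuous on the range of \<open>h\<close>, so a set of diameter \<open>d\<close> meets that
  range in the image of a set of length \<open>O(d powr s)\<close>. Transporting Lebesgue measure to the range
  in this way is the mass distribution principle.
\<close>

lemma hausdorff_dim_ge_of_inverse_hoelder:
  fixes h :: "real \<Rightarrow> 'a::metric_space"
  assumes "s > 0" and "C > 0"
    and range: "h ` {0..<1} \<subseteq> A"
    and hoelder: "\<And>u v. u \<in> {0..<1} \<Longrightarrow> v \<in> {0..<1} \<Longrightarrow> \<bar>u - v\<bar> \<le> C * dist (h u) (h v) powr s"
  shows "ennreal s \<le> hausdorff_dim A"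
  unfolding hausdorff_dim_def
proof (rule Inf_greatest, clarify)
  fix t :: real assume "0 \<le> t" and zero: "hausdorff_outer_measure t A = 0"
  show "ennreal s \<le> ennreal t"
  proof (rule ccontr)
    assume "\<not> ennreal s \<le> ennreal t"
    with \<open>0 \<le> t\<close> have "t < s"
      by (meson ennreal_leI not_le)
    have "ennreal (1 / (2 * C)) \<le> hausdorff_premeasure t 1 A"
      unfolding hausdorff_premeasure_def
    proof (rule INF_greatest, clarify)
      fix D :: "nat \<Rightarrow> 'a set"
      assume cover: "A \<subseteq> (\<Union>n. D n)" and D: "\<forall>n. bounded (D n) \<and> diameter (D n) \<le> 1"
      define P where "P n = {u \<in> {0..<1}. h u \<in> D n}" for n
      have "\<exists>I \<in> sets lborel. P n \<subseteq> I \<and> emeasure lborel I \<le> ennreal (2 * C) * diam_weight t (D n)" for n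
      proof (cases "P n = {}")
        case False
        then obtain u where u: "u \<in> P n" by blast
        define r where "r = C * diameter (D n) powr s"
        have bd: "bounded (D n)" and le1: "diameter (D n) \<le> 1"
          using D by auto
        have ge0: "0 \<le> diameter (D n)"
          using bd by (rule diameter_ge_0)
        have "r \<ge> 0" using \<open>C > 0\<close> by (simp add: r_def)
        have "P n \<subseteq> {u - r..u + r}"
        proof
          fix v assume v: "v \<in> P n"
          have "dist (h u) (h v) \<le> diameter (D n)"
            using u v bd by (auto simp: P_def intro: diameter_bounded_bound)
          then have "C * dist (h u) (h v) powr s \<le> r"
            using \<open>s > 0\<close> \<open>C > 0\<close> by (simp add: r_def powr_mono2)
          moreover have "\<bar>u - v\<bar> \<le> C * dist (h u) (h v) powr s"
            using u v by (intro hoelder) (auto simp: P_def)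
          ultimately show "v \<in> {u - r..u + r}" by auto
        qed
        moreover have "emeasure lborel {u - r..u + r} \<le> ennreal (2 * C) * diam_weight t (D n)"
        proof -
          have ne: "D n \<noteq> {}" using u by (auto simp: P_def)
          have "ennreal (diameter (D n) powr s) \<le> diam_weight t (D n)"
          proof (cases "t = 0")
            case True
            then show ?thesis
              using ne ge0 le1 \<open>s > 0\<close> by (simp add: diam_weight_def powr_le1)
          next
            case False
            then show ?thesis
              using ne ge0 le1 \<open>t < s\<close> by (simp add: diam_weight_def powr_mono')
          qed
          then have "ennreal (2 * C) * ennreal (diameter (D n) powr s)
              \<le> ennreal (2 * C) * diam_weight t (D n)"
            by (rule mult_left_mono) simp
          moreover have "emeasure lborel {u - r..u + r} = ennreal (2 * C) * ennreal (diameter (D n) powr s)"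
            using \<open>r \<ge> 0\<close> \<open>C > 0\<close> by (simp add: r_def ennreal_mult[symmetric])
          ultimately show ?thesis by simp
        qed
        ultimately show ?thesis by (intro bexI[of _ "{u - r..u + r}"]) auto
      qed (auto intro: bexI[of _ "{}"])
      then obtain I where I: "\<And>n. I n \<in> sets lborel" "\<And>n. P n \<subseteq> I n"
        "\<And>n. emeasure lborel (I n) \<le> ennreal (2 * C) * diam_weight t (D n)"
        by metis
      have "{0..<1::real} \<subseteq> (\<Union>n. I n)"
      proof
        fix u :: real assume u: "u \<in> {0..<1}"
        then obtain n where "h u \<in> D n" using range cover by blast
        with u have "u \<in> P n" by (simp add: P_def)
        then show "u \<in> (\<Union>n. I n)" using I(2) by blast
      qed
      then have "emeasure lborel {0..<1::real} \<le> emeasure lborel (\<Union>n. I n)"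
        using I(1) by (intro emeasure_mono) auto
      also have "\<dots> \<le> (\<Sum>n. emeasure lborel (I n))"
        using I(1) by (intro emeasure_subadditive_countably) auto
      also have "\<dots> \<le> (\<Sum>n. ennreal (2 * C) * diam_weight t (D n))"
        by (intro suminf_le I(3)) auto
      also have "\<dots> = ennreal (2 * C) * (\<Sum>n. diam_weight t (D n))"
        by (rule ennreal_suminf_cmult)
      finally have "1 \<le> ennreal (2 * C) * (\<Sum>n. diam_weight t (D n))" by simp
      then have "ennreal (1 / (2 * C)) * 1
          \<le> ennreal (1 / (2 * C)) * (ennreal (2 * C) * (\<Sum>n. diam_weight t (D n)))"
        by (rule mult_left_mono) simp
      also have "\<dots> = (\<Sum>n. diam_weight t (D n))"
        using \<open>C > 0\<close> by (simp add: mult.assoc[symmetric] ennreal_mult[symmetric])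
      finally show "ennreal (1 / (2 * C)) \<le> (\<Sum>n. diam_weight t (D n))" by simp
    qed
    also have "\<dots> \<le> hausdorff_outer_measure t A"
      unfolding hausdorff_outer_measure_def by (rule SUP_upper) simp
    finally show False using zero \<open>C > 0\<close> by simp
  qed
qed

section \<open>Uniqueness of blockwise constant addresses\<close>

lemma suminf_ge_term_minus_tail:
  fixes a :: "nat \<Rightarrow> real"
  assumes nonneg: "\<And>n. n < N \<Longrightarrow> 0 \<le> a n" and "k < N"
    and tail: "\<And>n. \<bar>a (n + N)\<bar> \<le> B * r ^ n" and "0 \<le> r" and "r < 1"
  shows "a k - B / (1 - r) \<le> suminf a"
proof -
  have geo: "(\<lambda>n. B * r ^ n) sums (B * (1 / (1 - r)))"
    using assms by (intro sums_mult geometric_sums) auto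
  have sum_tail: "summable (\<lambda>n. a (n + N))"
    by (rule summable_comparison_test'[OF sums_summable[OF geo], of 0]) (use tail in auto)
  then have "summable a" by (simp add: summable_iff_shift)
  then have "suminf a = (\<Sum>n. a (n + N)) + sum a {..<N}"
    by (rule suminf_split_initial_segment)
  moreover have "a k \<le> sum a {..<N}"
    using \<open>k < N\<close> nonneg by (intro member_le_sum) auto
  moreover have "- (B / (1 - r)) \<le> (\<Sum>n. a (n + N))"
  proof -
    have "(\<Sum>n. - (B * r ^ n)) \<le> (\<Sum>n. a (n + N))"
      using tail geo by (intro suminf_le sum_tail summable_minus)
        (auto simp: sums_iff abs_le_iff minus_le_iff)
    then show ?thesis using geo by (simp add: sums_iff suminf_minus)
  qed
  ultimately show ?thesis by linarith
qed

lemma pm_seqs_abs: "w \<in> pm_seqs \<Longrightarrow> \<bar>w n\<bar> = 1"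
  by (auto simp: pm_seqs_def dest!: spec[of _ n])

lemma summable_signs_power:
  fixes x :: real
  assumes "w \<in> pm_seqs" and "0 < x" and "x < 1"
  shows "summable (\<lambda>n. w n * x ^ n)"
  by (rule summable_comparison_test'[of "\<lambda>n. x ^ n" 0])
    (use assms in \<open>auto simp: abs_mult pm_seqs_abs summable_geometric\<close>)

lemma signs_diff_mult_nonneg:
  assumes "w \<in> pm_seqs" and "w' \<in> pm_seqs" and "0 \<le> w n * c"
  shows "0 \<le> (w n - w' n) * c"
proof -
  have "w n \<in> {1, -1}" "w' n \<in> {1, -1}"
    using assms(1,2) by (auto simp: pm_seqs_def)
  with assms(3) show ?thesis by auto
qed

lemma signs_diff_abs_le:
  assumes "w \<in> pm_seqs" and "w' \<in> pm_seqs"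
  shows "\<bar>w n - w' n\<bar> \<le> 2"
  using pm_seqs_abs[OF assms(1), of n] pm_seqs_abs[OF assms(2), of n] by linarith

lemma signs_first_difference:
  assumes "w \<in> pm_seqs" and "w' \<in> pm_seqs" and "w n \<noteq> w' n"
  shows "(w n - w' n) * w n = 2"
proof -
  have "w n \<in> {1, -1}" "w' n \<in> {1, -1}"
    using assms(1,2) by (auto simp: pm_seqs_def)
  with assms(3) show ?thesis by auto
qed

definition blocks :: "nat \<Rightarrow> (nat \<Rightarrow> real) \<Rightarrow> nat \<Rightarrow> real" where
  "blocks L e n = e (n div L)"

lemma blocks_pm_seqs: "e \<in> pm_seqs \<Longrightarrow> blocks L e \<in> pm_seqs"
  by (simp add: pm_seqs_def blocks_def)

text \<open>
  A change of sign can only happen at the start of a block, so a whole block of the new sign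
  follows.
\<close>

lemma blocks_run_length:
  assumes "L > 0" and "k < K" and "blocks L e K \<noteq> blocks L e k"
    and before: "\<And>n. k \<le> n \<Longrightarrow> n < K \<Longrightarrow> blocks L e n = blocks L e k"
    and "K \<le> n" and "n < K + L"
  shows "blocks L e n = blocks L e K"
proof -
  define b where "b = L * (K div L)"
  have "b div L = K div L" using \<open>L > 0\<close> by (simp add: b_def)
  then have eq: "blocks L e b = blocks L e K" by (simp add: blocks_def)
  have "b \<le> K" by (simp add: b_def)
  have "k < b"
  proof (rule ccontr)
    assume "\<not> k < b"
    then have "K div L \<le> k div L" using \<open>b div L = K div L\<close> by (metis div_le_mono not_less)
    moreover have "k div L \<le> K div L" using \<open>k < K\<close> by (intro div_le_mono) auto
    ultimately show False using assms(3) by (simp add: blocks_def)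
  qed
  then have "b = K"
    using before[of b] eq assms(3) \<open>b \<le> K\<close> by fastforce
  moreover have "L * (K div L) \<le> n" "n < L * Suc (K div L)"
    using \<open>b = K\<close> assms(5,6) by (auto simp: b_def)
  then have "n div L = K div L"
    by (intro div_nat_eqI) (auto simp: mult.commute)
  ultimately show ?thesis by (simp add: blocks_def)
qed

text \<open>
  The hypothesis on \<open>L\<close> compares the two ends of the sum that must vanish: with
  \<open>f n = x ^ n - (x / y) ^ K * y ^ n\<close>, the term at the first difference \<open>k\<close> is at least
  \<open>2 * x ^ k * (1 - x / y)\<close>, and the terms from \<open>K + L\<close> on, bounded by
  \<open>2 * x ^ K * y ^ (n - K)\<close>, add up to at most \<open>2 * x ^ k * y ^ L / (1 - y)\<close>.
\<close>

lemma blocks_series_unique: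
  fixes x y :: real
  assumes "0 < x" and "x < y" and "y < 1" and "L > 0"
    and L: "y ^ L < (1 - y) * (1 - x / y)"
    and e: "e \<in> pm_seqs" and w': "w' \<in> pm_seqs"
    and eq_x: "(\<Sum>n. blocks L e n * x ^ n) = (\<Sum>n. w' n * x ^ n)"
    and eq_y: "(\<Sum>n. blocks L e n * y ^ n) = (\<Sum>n. w' n * y ^ n)"
  shows "w' = blocks L e"
proof (rule ccontr)
  assume "w' \<noteq> blocks L e"
  define w where "w = blocks L e"
  have w: "w \<in> pm_seqs" using e by (simp add: w_def blocks_pm_seqs)
  define k where "k = (LEAST n. w n \<noteq> w' n)"
  have "\<exists>n. w n \<noteq> w' n" using \<open>w' \<noteq> blocks L e\<close> by (auto simp: w_def)
  then have k: "w k \<noteq> w' k" unfolding k_def by (rule LeastI_ex)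
  have before_k: "w n = w' n" if "n < k" for n
    using not_less_Least[of n "\<lambda>n. w n \<noteq> w' n"] that by (auto simp: k_def)
  have sx: "(\<lambda>n. (w n - w' n) * x ^ n) sums 0"
    using summable_signs_power[OF w, of x] summable_signs_power[OF w', of x] assms eq_x
    by (auto simp: w_def[symmetric] sums_iff left_diff_distrib summable_diff suminf_diff[symmetric])
  have sy: "(\<lambda>n. (w n - w' n) * y ^ n) sums 0"
    using summable_signs_power[OF w, of y] summable_signs_power[OF w', of y] assms eq_y
    by (auto simp: w_def[symmetric] sums_iff left_diff_distrib summable_diff suminf_diff[symmetric])
  have wk: "w k * w k = 1"
    using pm_seqs_abs[OF w, of k] by (metis abs_mult_self_eq mult_1)
  have vanish: "(\<lambda>n. (w n - w' n) * (w k * (x ^ n - c * y ^ n))) sums 0" for c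
    using sums_mult[OF sums_diff[OF sx sums_mult[OF sy, of c]], of "w k"]
    by (simp add: algebra_simps)
  show False
  proof (cases "\<exists>K>k. w K \<noteq> w k")
    case False
    \<comment> \<open>From \<open>k\<close> on \<open>w\<close> is constant, so the positive function \<open>x ^ n\<close>, with \<open>c = 0\<close>, suffices.\<close>
    have "0 \<le> (w n - w' n) * (w k * (x ^ n - 0 * y ^ n))" for n
    proof (cases "n < k")
      case False
      with \<open>\<not> (\<exists>K>k. w K \<noteq> w k)\<close> have "w n = w k" by (metis nat_neq_iff)
      then have "w n * (w k * (x ^ n - 0 * y ^ n)) = x ^ n"
        using wk by (simp add: mult.assoc[symmetric])
      also have "0 \<le> x ^ n" using \<open>0 < x\<close> by simp
      finally show ?thesis by (intro signs_diff_mult_nonneg w w')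
    qed (simp add: before_k)
    moreover have "(w k - w' k) * (w k * (x ^ k - 0 * y ^ k)) = 2 * x ^ k"
      using signs_first_difference[OF w w' k] by (simp add: mult.assoc[symmetric])
    moreover have "0 < 2 * x ^ k" using \<open>0 < x\<close> by simp
    ultimately have "0 < (\<Sum>n. (w n - w' n) * (w k * (x ^ n - 0 * y ^ n)))"
      using vanish[of 0] by (intro suminf_pos2[where i = k]) (auto dest: sums_summable simp only:)
    then show False using vanish[of 0] by (simp add: sums_iff)
  next
    case True
    define K where "K = (LEAST K. k < K \<and> w K \<noteq> w k)"
    have K: "k < K" "w K \<noteq> w k"
      using LeastI_ex[OF True] by (auto simp: K_def)
    have before_K: "w n = w k" if "k \<le> n" "n < K" for n
      using not_less_Least[of n "\<lambda>K. k < K \<and> w K \<noteq> w k"] that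
      by (cases "n = k") (auto simp: K_def)
    have wK: "w K = - w k"
    proof -
      have "w K \<in> {1, -1}" "w k \<in> {1, -1}" using w by (auto simp: pm_seqs_def)
      with K(2) show ?thesis by auto
    qed
    have after_K: "w n = - w k" if "K \<le> n" "n < K + L" for n
      using blocks_run_length[OF \<open>L > 0\<close> K(1), of e, folded w_def, OF K(2) before_K that] wK
      by simp
    \<comment> \<open>This choice of \<open>c\<close> puts the zero of \<open>f\<close> exactly at \<open>K\<close>, the change of sign of \<open>w\<close>.\<close>
    define f where "f n = x ^ n - (x / y) ^ K * y ^ n" for n
    have f_eq: "f n = y ^ n * ((x / y) ^ n - (x / y) ^ K)" for n
      using \<open>0 < x\<close> \<open>x < y\<close> by (simp add: f_def field_simps)
    have q: "0 < x / y" "x / y < 1" using \<open>0 < x\<close> \<open>x < y\<close> by auto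
    have f_nonneg: "0 \<le> f n" if "n \<le> K" for n
      using q that \<open>0 < x\<close> \<open>x < y\<close> unfolding f_eq by (auto intro!: mult_nonneg_nonneg power_decreasing)
    have f_nonpos: "f n \<le> 0" if "K \<le> n" for n
      using q that \<open>0 < x\<close> \<open>x < y\<close> unfolding f_eq by (auto intro!: mult_nonneg_nonpos power_decreasing)
    define a where "a n = (w n - w' n) * (w k * f n)" for n
    have "a sums 0" using vanish[of "(x / y) ^ K"] by (simp add: a_def[abs_def] f_def)
    have "a k - 2 * (x ^ K * y ^ L) / (1 - y) \<le> suminf a"
    proof (rule suminf_ge_term_minus_tail[where N = "K + L"])
      show "k < K + L" using K(1) by simp
      show "0 \<le> y" "y < 1" using assms by auto
      fix n
      show "0 \<le> a n" if "n < K + L"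
      proof (cases "n < k")
        case True
        then show ?thesis by (simp add: a_def before_k)
      next
        case False
        have "0 \<le> w n * (w k * f n)"
        proof (cases "n < K")
          case True
          then have "w n * (w k * f n) = f n"
            using before_K[of n] False wk by (simp add: mult.assoc[symmetric])
          also have "0 \<le> f n" using f_nonneg True by simp
          finally show ?thesis .
        next
          case False
          then have "w n * (w k * f n) = - f n"
            using after_K[of n] that wk by (simp add: mult.assoc[symmetric])
          also have "0 \<le> - f n" using f_nonpos False by simp
          finally show ?thesis .
        qed
        then show ?thesis unfolding a_def by (intro signs_diff_mult_nonneg w w')
      qed
      have "\<bar>f (n + (K + L))\<bar> = (x / y) ^ K * y ^ (n + (K + L)) - x ^ (n + (K + L))"
        using f_nonpos[of "n + (K + L)"] by (simp add: f_def)
      also have "\<dots> \<le> (x / y) ^ K * y ^ (n + (K + L))"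
        using \<open>0 < x\<close> by simp
      also have "\<dots> = x ^ K * y ^ L * y ^ n"
        using \<open>0 < x\<close> \<open>x < y\<close> by (simp add: power_add power_divide)
      finally have "\<bar>f (n + (K + L))\<bar> \<le> x ^ K * y ^ L * y ^ n" .
      then have "\<bar>w (n + (K + L)) - w' (n + (K + L))\<bar> * \<bar>f (n + (K + L))\<bar> \<le> 2 * (x ^ K * y ^ L * y ^ n)"
        using signs_diff_abs_le[OF w w'] by (intro mult_mono) auto
      then show "\<bar>a (n + (K + L))\<bar> \<le> 2 * (x ^ K * y ^ L) * y ^ n"
        by (simp add: a_def abs_mult pm_seqs_abs[OF w])
    qed
    moreover have "2 * (x ^ K * y ^ L) / (1 - y) < a k"
    proof -
      have "x ^ K \<le> x ^ k"
        using K(1) assms by (intro power_decreasing) auto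
      then have "x ^ K * y ^ L \<le> x ^ k * y ^ L"
        using \<open>0 < x\<close> \<open>x < y\<close> by (intro mult_right_mono) auto
      also have "\<dots> < x ^ k * ((1 - y) * (1 - x / y))"
        using L \<open>0 < x\<close> by (intro mult_strict_left_mono) auto
      finally have "x ^ K * y ^ L / (1 - y) < x ^ k * (1 - x / y)"
        using \<open>y < 1\<close> by (simp add: pos_divide_less_eq mult_ac)
      also have "\<dots> \<le> f k"
      proof -
        have "(x / y) ^ (K - k) \<le> (x / y) ^ 1"
          using K(1) q by (intro power_decreasing) auto
        then have "x ^ k * (1 - x / y) \<le> x ^ k * (1 - (x / y) ^ (K - k))"
          using \<open>0 < x\<close> by (intro mult_left_mono) auto
        also have "\<dots> = x ^ k - x ^ k * (x / y) ^ (K - k)" by (simp add: algebra_simps)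
        also have "x ^ k * (x / y) ^ (K - k) = y ^ k * ((x / y) ^ k * (x / y) ^ (K - k))"
          using \<open>0 < x\<close> \<open>x < y\<close> by (simp add: power_divide)
        also have "(x / y) ^ k * (x / y) ^ (K - k) = (x / y) ^ K"
          using K(1) by (simp add: power_add[symmetric])
        finally show ?thesis by (simp add: f_def mult.commute)
      qed
      finally have "2 * (x ^ K * y ^ L / (1 - y)) < 2 * f k" by simp
      moreover have "a k = 2 * f k"
        using signs_first_difference[OF w w' k] by (simp add: a_def mult.assoc[symmetric])
      ultimately show ?thesis by simp
    qed
    ultimately show False using \<open>a sums 0\<close> by (simp add: sums_iff)
  qed
qed

lemma address_series_eq_power_series:
  fixes \<beta> :: real
  assumes "\<beta> > 1" and "w \<in> pm_seqs"
  shows "(\<Sum>n. w n / \<beta> ^ Suc n) = (1 / \<beta>) * (\<Sum>n. w n * (1 / \<beta>) ^ n)"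
  using suminf_mult[OF summable_signs_power[OF assms(2), of "1 / \<beta>"], of "1 / \<beta>"] assms
  by (simp add: power_divide mult.commute)

lemma blocks_address_unique:
  fixes \<beta>1 \<beta>2 :: real
  assumes "\<beta>1 > 1" and "\<beta>2 > 1" and "\<beta>1 \<noteq> \<beta>2" and "L > 0" and e: "e \<in> pm_seqs"
    and x: "x = min (1 / \<beta>1) (1 / \<beta>2)" and y: "y = max (1 / \<beta>1) (1 / \<beta>2)"
    and L: "y ^ L < (1 - y) * (1 - x / y)"
  shows "blocks L e \<in> unique_addresses \<beta>1 \<beta>2"
proof -
  have "w' = blocks L e"
    if w': "w' \<in> pm_seqs" and eq: "address_map \<beta>1 \<beta>2 w' = address_map \<beta>1 \<beta>2 (blocks L e)" for w'
  proof -
    have eq1: "(\<Sum>n. blocks L e n * (1 / \<beta>1) ^ n) = (\<Sum>n. w' n * (1 / \<beta>1) ^ n)"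
      and eq2: "(\<Sum>n. blocks L e n * (1 / \<beta>2) ^ n) = (\<Sum>n. w' n * (1 / \<beta>2) ^ n)"
      using eq assms(1,2) blocks_pm_seqs[OF e] w'
      unfolding address_map_def by (simp_all only: address_series_eq_power_series prod.inject, simp_all)
    have "0 < x" "x < y" "y < 1"
      using assms(1-3) by (auto simp: x y min_def max_def field_simps)
    then show ?thesis
    proof (rule blocks_series_unique[OF _ _ _ \<open>L > 0\<close> L e w'])
      show "(\<Sum>n. blocks L e n * x ^ n) = (\<Sum>n. w' n * x ^ n)"
        using eq1 eq2 by (simp only: x min_def split: if_split) simp
      show "(\<Sum>n. blocks L e n * y ^ n) = (\<Sum>n. w' n * y ^ n)"
        using eq1 eq2 by (simp only: y max_def split: if_split) simp
    qed
  qed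
  then show ?thesis
    using blocks_pm_seqs[OF e] by (auto simp: unique_addresses_def)
qed

section \<open>Separation of blockwise constant addresses\<close>

text \<open>
  Within block \<open>q\<close> all differences have the same sign, so the first of them, of size
  \<open>2 * x ^ (L * q)\<close>, is a lower bound for the contribution of the block, and the bound on \<open>x ^ L\<close>
  makes the remaining blocks contribute at most half of that.
\<close>

lemma blocks_series_separated:
  fixes x :: real
  assumes "0 < x" and "x < 1" and "L > 0" and L: "x ^ L \<le> (1 - x) / 2"
    and e: "e \<in> pm_seqs" and e': "e' \<in> pm_seqs"
    and before: "\<And>j. j < q \<Longrightarrow> e j = e' j" and "e q \<noteq> e' q"
  shows "x ^ (L * q) \<le> \<bar>(\<Sum>n. blocks L e n * x ^ n) - (\<Sum>n. blocks L e' n * x ^ n)\<bar>"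
proof -
  define a where "a n = e q * ((blocks L e n - blocks L e' n) * x ^ n)" for n
  have w: "blocks L e \<in> pm_seqs" "blocks L e' \<in> pm_seqs"
    using e e' by (auto intro: blocks_pm_seqs)
  have sm: "summable (\<lambda>n. blocks L e n * x ^ n)" "summable (\<lambda>n. blocks L e' n * x ^ n)"
    using w assms(1,2) by (auto intro: summable_signs_power)
  have "suminf a = e q * ((\<Sum>n. blocks L e n * x ^ n) - (\<Sum>n. blocks L e' n * x ^ n))"
    unfolding a_def left_diff_distrib
    using sm by (simp add: suminf_mult summable_diff suminf_diff)
  then have "suminf a \<le> \<bar>(\<Sum>n. blocks L e n * x ^ n) - (\<Sum>n. blocks L e' n * x ^ n)\<bar>"
    using pm_seqs_abs[OF e, of q] by (metis abs_ge_self abs_mult mult_1)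
  moreover have "a (L * q) - 2 * x ^ (L * q + L) / (1 - x) \<le> suminf a"
  proof (rule suminf_ge_term_minus_tail[where N = "L * q + L"])
    show "L * q < L * q + L" using \<open>L > 0\<close> by simp
    show "0 \<le> x" "x < 1" using assms by auto
    fix n
    show "0 \<le> a n" if "n < L * q + L"
    proof -
      have "n div L \<le> q"
        using that \<open>L > 0\<close> by (simp add: less_Suc_eq_le[symmetric] div_less_iff_less_mult mult.commute)
      then consider "n div L < q" | "n div L = q" by linarith
      then show ?thesis
      proof cases
        case 1
        then show ?thesis by (simp add: a_def blocks_def before)
      next
        case 2
        then have "a n = ((e q - e' q) * e q) * x ^ n" by (simp add: a_def blocks_def)
        then show ?thesis
          using signs_first_difference[OF e e' \<open>e q \<noteq> e' q\<close>] \<open>0 < x\<close> by simp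
      qed
    qed
    have "\<bar>blocks L e (n + (L * q + L)) - blocks L e' (n + (L * q + L))\<bar> * x ^ (n + (L * q + L))
        \<le> 2 * x ^ (n + (L * q + L))"
      using signs_diff_abs_le[OF w] \<open>0 < x\<close> by (intro mult_right_mono) auto
    then show "\<bar>a (n + (L * q + L))\<bar> \<le> 2 * x ^ (L * q + L) * x ^ n"
      using \<open>0 < x\<close> by (simp add: a_def abs_mult pm_seqs_abs[OF e] power_add mult_ac)
  qed
  moreover have "a (L * q) = 2 * x ^ (L * q)"
  proof -
    have "a (L * q) = ((e q - e' q) * e q) * x ^ (L * q)"
      using \<open>L > 0\<close> by (simp add: a_def blocks_def)
    then show ?thesis using signs_first_difference[OF e e' \<open>e q \<noteq> e' q\<close>] by simp
  qed
  moreover have "2 * x ^ (L * q + L) / (1 - x) \<le> x ^ (L * q)"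
  proof -
    have "2 * x ^ L / (1 - x) \<le> 1" using L \<open>x < 1\<close> by (simp add: field_simps)
    then have "x ^ (L * q) * (2 * x ^ L / (1 - x)) \<le> x ^ (L * q) * 1"
      using \<open>0 < x\<close> by (intro mult_left_mono) auto
    then show ?thesis by (simp add: power_add mult_ac)
  qed
  ultimately show ?thesis by linarith
qed

section \<open>Binary coding of the unit interval\<close>

definition binary_signs :: "real \<Rightarrow> nat \<Rightarrow> real" where
  "binary_signs u q = (if even \<lfloor>2 ^ Suc q * u\<rfloor> then 1 else -1)"

lemma binary_signs_pm_seqs: "binary_signs u \<in> pm_seqs"
  by (simp add: pm_seqs_def binary_signs_def)

text \<open>
  By induction on \<open>q\<close>, the first \<open>q\<close> digits determine \<open>\<lfloor>2 ^ q * u\<rfloor>\<close>: they determine its integer half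
  \<open>\<lfloor>2 ^ (q - 1) * u\<rfloor>\<close> and its parity.
\<close>

lemma binary_signs_agree_close:
  assumes u: "u \<in> {0..<1}" and v: "v \<in> {0..<1}"
    and agree: "\<And>j. j < q \<Longrightarrow> binary_signs u j = binary_signs v j"
  shows "\<bar>u - v\<bar> \<le> (1/2) ^ q"
proof -
  have "\<lfloor>2 ^ q * u\<rfloor> = \<lfloor>2 ^ q * v\<rfloor>"
    using agree
  proof (induction q)
    case 0
    have "\<lfloor>u\<rfloor> = 0" "\<lfloor>v\<rfloor> = 0" using u v by (auto simp: floor_eq_iff)
    then show ?case by simp
  next
    case (Suc q)
    have half: "\<lfloor>2 ^ Suc q * z\<rfloor> div 2 = \<lfloor>2 ^ q * z\<rfloor>" for z :: real
      using floor_divide_real_eq_div[of 2 "2 ^ Suc q * z"] by simp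
    have "even \<lfloor>2 ^ Suc q * u\<rfloor> \<longleftrightarrow> even \<lfloor>2 ^ Suc q * v\<rfloor>"
      using Suc.prems[of q] by (auto simp: binary_signs_def split: if_splits)
    moreover have "\<lfloor>2 ^ Suc q * u\<rfloor> div 2 = \<lfloor>2 ^ Suc q * v\<rfloor> div 2"
      unfolding half using Suc by simp
    ultimately show ?case by presburger
  qed
  then have "\<bar>2 ^ q * u - 2 ^ q * v\<bar> \<le> 1" by linarith
  then have "2 ^ q * \<bar>u - v\<bar> \<le> 1"
    by (simp add: right_diff_distrib[symmetric] abs_mult)
  then show ?thesis by (simp add: field_simps power_divide)
qed

lemma binary_signs_first_difference:
  assumes "u \<in> {0..<1}" and "v \<in> {0..<1}" and "u \<noteq> v"
  obtains q where "\<And>j. j < q \<Longrightarrow> binary_signs u j = binary_signs v j"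
    and "binary_signs u q \<noteq> binary_signs v q"
proof -
  have "\<exists>q. binary_signs u q \<noteq> binary_signs v q"
  proof (rule ccontr)
    assume "\<not> ?thesis"
    then have "\<bar>u - v\<bar> \<le> (1/2) ^ q" for q
      using assms by (intro binary_signs_agree_close) auto
    moreover obtain q where "(1/2) ^ q < \<bar>u - v\<bar>"
      using real_arch_pow_inv[of "\<bar>u - v\<bar>" "1/2"] \<open>u \<noteq> v\<close> by auto
    ultimately show False by (meson not_le)
  qed
  then show ?thesis
    using that[of "LEAST q. binary_signs u q \<noteq> binary_signs v q"]
      LeastI_ex[of "\<lambda>q. binary_signs u q \<noteq> binary_signs v q"] not_less_Least by blast
qed

section \<open>Positive dimension\<close>

theorem corollary4p3:
  fixes \<beta>1 \<beta>2 :: real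
  assumes "\<beta>1 > 1" and "\<beta>2 > 1" and "\<beta>1 \<noteq> \<beta>2"
  shows "hausdorff_dim (uniqueness_set \<beta>1 \<beta>2) > 0"
proof -
  define x where "x = min (1 / \<beta>1) (1 / \<beta>2)"
  define y where "y = max (1 / \<beta>1) (1 / \<beta>2)"
  define z where "z = 1 / \<beta>1"
  have xy: "0 < x" "x < y" "y < 1"
    using assms by (auto simp: x_def y_def min_def max_def field_simps)
  have z: "0 < z" "z < 1" using assms by (auto simp: z_def)
  have "\<forall>\<^sub>F L in sequentially. y ^ L < (1 - y) * (1 - x / y)"
    using xy by (intro order_tendstoD(2)[OF LIMSEQ_realpow_zero]) auto
  moreover have "\<forall>\<^sub>F L in sequentially. z ^ L < (1 - z) / 2"
    using z by (intro order_tendstoD(2)[OF LIMSEQ_realpow_zero]) auto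
  ultimately have "\<forall>\<^sub>F L in sequentially. y ^ L < (1 - y) * (1 - x / y) \<and> z ^ L < (1 - z) / 2 \<and> L > 0"
    by (intro eventually_conj eventually_gt_at_top)
  then obtain L where L: "y ^ L < (1 - y) * (1 - x / y)" "z ^ L < (1 - z) / 2" "L > 0"
    using eventually_happens'[OF sequentially_bot] by blast
  \<comment> \<open>If the signs of two numbers in \<open>[0,1)\<close> differ first at \<open>q\<close>, the numbers are at most \<open>(1/2) ^ q\<close>
    apart and their images at least \<open>z * (z ^ L) ^ q\<close>. The exponent \<open>s\<close> turns \<open>z ^ L\<close> into \<open>1/2\<close>.\<close>
  define s where "s = ln (1/2) / ln (z ^ L)"
  have zL: "0 < z ^ L" "z ^ L < 1" using z L(3) by (auto simp: power_Suc_less_one power_less_one_iff)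
  have "s > 0" using zL by (auto simp: s_def intro!: divide_neg_neg)
  have half: "(z ^ L) powr s = 1/2"
  proof -
    have "ln (z ^ L) \<noteq> 0" using zL by simp
    then have "s * ln (z ^ L) = ln (1/2)" by (simp only: s_def) simp
    then show ?thesis using zL z by (simp add: powr_def del: ln_realpow)
  qed
  define h where "h u = address_map \<beta>1 \<beta>2 (blocks L (binary_signs u))" for u
  have "h ` {0..<1} \<subseteq> uniqueness_set \<beta>1 \<beta>2"
    using blocks_address_unique[OF assms L(3) binary_signs_pm_seqs x_def y_def L(1)]
    by (auto simp: h_def uniqueness_set_def)
  moreover have "\<bar>u - v\<bar> \<le> (1 / z) powr s * dist (h u) (h v) powr s"
    if u: "u \<in> {0..<1}" and v: "v \<in> {0..<1}" for u v
  proof (cases "u = v")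
    case False
    obtain q where q: "\<And>j. j < q \<Longrightarrow> binary_signs u j = binary_signs v j"
      "binary_signs u q \<noteq> binary_signs v q"
      using binary_signs_first_difference[OF u v False] by blast
    have fst_h: "fst (h r) = z * (\<Sum>n. blocks L (binary_signs r) n * z ^ n)" for r
      unfolding h_def address_map_def fst_conv z_def
      by (rule address_series_eq_power_series[OF assms(1) blocks_pm_seqs[OF binary_signs_pm_seqs]])
    have "z * z ^ (L * q) \<le> z * \<bar>(\<Sum>n. blocks L (binary_signs u) n * z ^ n)
        - (\<Sum>n. blocks L (binary_signs v) n * z ^ n)\<bar>"
      using z L q by (intro mult_left_mono blocks_series_separated binary_signs_pm_seqs) auto
    also have "\<dots> = dist (fst (h u)) (fst (h v))"
      using z by (simp add: fst_h dist_real_def right_diff_distrib[symmetric] abs_mult)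
    also have "\<dots> \<le> dist (h u) (h v)" by (rule dist_fst_le)
    finally have "z ^ (L * q) \<le> 1 / z * dist (h u) (h v)"
      using z by (simp add: field_simps)
    then have "(z ^ (L * q)) powr s \<le> (1 / z * dist (h u) (h v)) powr s"
      using z \<open>s > 0\<close> by (intro powr_mono2) auto
    also have "\<dots> = (1 / z) powr s * dist (h u) (h v) powr s"
      by (rule powr_mult)
    also have "(z ^ (L * q)) powr s = ((z ^ L) powr s) ^ q"
    proof -
      have "(c ^ q) powr s = (c powr s) ^ q" if "0 < c" for c :: real
        using that by (simp add: powr_power powr_realpow[symmetric] powr_powr mult.commute)
      from this[OF zL(1)] show ?thesis by (simp add: power_mult)
    qed
    finally have "(1/2) ^ q \<le> (1 / z) powr s * dist (h u) (h v) powr s"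
      by (simp only: half)
    then show ?thesis
      using binary_signs_agree_close[OF u v, of q] q(1) by force
  qed simp
  ultimately have "ennreal s \<le> hausdorff_dim (uniqueness_set \<beta>1 \<beta>2)"
    using \<open>s > 0\<close> z by (intro hausdorff_dim_ge_of_inverse_hoelder[where C = "(1 / z) powr s"]) auto
  then show ?thesis
    using \<open>s > 0\<close> by (meson ennreal_less_zero_iff less_le_trans)
qed

end
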